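(* Let $a\in\mathbb{R}$, $K\in\mathbb{N}$, and let $x:\mathbb{N}_{a-K-1}\to\mathbb{R}$ and $w:\mathbb{N}_{a-K-1}\to\mathbb{R}\setminus\{0\}$. Then for every $k\in\mathbb{N}_{a+1}$ the following hold. (1) If $\alpha\in\mathbb{R}\setminus\mathbb{Z}_+$, then $${}_a^{\rm G}\nabla_k^{\alpha,w(k)}x(k)=\sum_{i=0}^{K}\binom{\alpha}{i}\frac{(k-a-i)^{\overline{i-\alpha}}}{\Gamma(i-\alpha+1)}\nabla^{i,w(k)}x(k)-\sum_{i=a+2}^{k}\frac{w(i)}{w(k)}\nabla^{K+1,w(i)}x(i)\sum_{j=a+2}^{i}\frac{(k-j+2)^{\overline{-\alpha-1}}}{\Gamma(-\alpha)}\frac{(j-i)^{\overline{K}}}{K!}.$$ (2) If $n\in\mathbb{Z}_+$ and $\alpha\in(n-1,n)$, then $${}_a^{\rm R}\nabla_k^{\alpha,w(k)}x(k)=\sum_{i=0}^{K}\binom{\alpha}{i}\frac{(k-a-i)^{\overline{i-\alpha}}}{\Gamma(i-\alpha+1)}\nabla^{i,w(k)}x(k)-\sum_{i=a+2}^{k}\frac{w(i)}{w(k)}\nabla^{K+1,w(i)}x(i)\sum_{j=a+2}^{i}\frac{(k-j+2)^{\overline{-\alpha-1}}}{\Gamma(-\alpha)}\frac{(j-i)^{\overline{K}}}{K!}.$$ (3) If $n\in\mathbb{Z}_+$, $\alpha\in(n-1,n)$ and $K\ge n$, then $${}_a^{\rm C}\nabla_k^{\alpha,w(k)}x(k)=\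sum_{i=n}^{K}\binom{\alpha-n}{i-n}\frac{(k-a-i+n)^{\overline{i-\alpha}}}{\Gamma(i-\alpha+1)}\nabla^{i,w(k)}x(k)-\sum_{i=a+2}^{k}\frac{w(i)}{w(k)}\nabla^{K+1,w(i)}x(i)\sum_{j=a+2}^{i}\frac{(k-j+2)^{\overline{n-\alpha-1}}}{\Gamma(n-\alpha)}\frac{(j-i)^{\overline{K-n}}}{(K-n)!}.$$
   Context: For $b\in\mathbb{R}$, $\mathbb{N}_b=\{b,b+1,b+2,\dots\}$; $\mathbb{N}=\{0,1,2,\dots\}$, $\mathbb{Z}_+=\{1,2,\dots\}$. $p^{\overline{q}}=\Gamma(p+q)/\Gamma(p)$ is the rising function, with $1/\Gamma$ equal to $0$ at $0,-1,-2,\dots$; for integer $q\ge 0$ it is the product $p(p+1)\cdots(p+q-1)$ (equal to $1$ for $q=0$), for every integer $p$. $\binom{p}{i}=\frac{p(p-1)\cdots(p-i+1)}{i!}$ for real $p$ and integer $i\ge 0$. Nabla difference: $\nabla^n z(k)=\sum_{i=0}^n(-1)^i\binom{n}{i}z(k-i)$, with $\nabla^0 z=z$. Grünwald–Letnikov difference/sum of order $\alpha\in\mathbb{R}$: ${}_a^{\rm G}\nabla_k^\alpha z(k)=\sum_{i=0}^{k-a-1}(-1)^i\binom{\alpha}{i}z(k-i)$; empty sums are $0$, so this equals $0$ at $k=a,a-1,\dots$. For $\alpha\in(n-1,n)$, Riemann–Liouville: ${}_a^{\rm R}\nabla_k^\alpha z(k)=\nabla^n\,{}_a^{\rm G}\nabla_k^{\alpha-n}z(k)$;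 Caputo: ${}_a^{\rm C}\nabla_k^\alpha z(k)={}_a^{\rm G}\nabla_k^{\alpha-n}\nabla^n z(k)$. Tempered versions, with tempered function $w$ (nowhere zero): for each of the operators $D$ among $\nabla^n$, ${}_a^{\rm G}\nabla_k^\alpha$, ${}_a^{\rm R}\nabla_k^\alpha$, ${}_a^{\rm C}\nabla_k^\alpha$ the tempered operator (written with the extra superscript $w(k)$) sends $x$ to $w^{-1}(k)\,D[w(k)x(k)]$, where $w^{-1}(k)=1/w(k)$. $\nabla^{K+1,w(i)}x(i)$ is the tempered difference evaluated at $i$. *)

theory Defs
  imports "HOL-Analysis.Analysis"
begin

definition nat_from :: "real \<Rightarrow> real set" where
  "nat_from b = {b + real m | m :: nat. True}"

definition nat_range :: "real \<Rightarrow> real \<Rightarrow> real set" where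
  "nat_range b c = {i \<in> nat_from b. i \<le> c}"

(* The library sets Gamma to 0 at its poles and x / 0 = 0, so dividing by Gamma at a pole
   yields 0, i.e. the convention 1 / Gamma = 0.  For q a natural number the quotient is read
   as the product p (p + 1) ... (p + q - 1), also where both Gammas have a pole. *)
definition rising :: "real \<Rightarrow> real \<Rightarrow> real" where
  "rising p q = (if q \<in> \<nat> then pochhammer p (nat \<lfloor>q\<rfloor>) else Gamma (p + q) / Gamma p)"

definition nabla :: "nat \<Rightarrow> (real \<Rightarrow> real) \<Rightarrow> real \<Rightarrow> real" where
  "nabla n z k = (\<Sum>i = 0..n. (-1) ^ i * real (n choose i) * z (k - real i))"

definition GL :: "real \<Rightarrow> real \<Rightarrow> (real \<Rightarrow> real) \<Rightarrow> real \<Rightarrow> real" where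
  "GL a \<alpha> z k = (\<Sum>i | real i \<le> k - a - 1. (-1) ^ i * (\<alpha> gchoose i) * z (k - real i))"

(* RL and Caputo are meant for n > 0 and real n - 1 < \<alpha> < real n, which determines n. *)
definition RL :: "real \<Rightarrow> nat \<Rightarrow> real \<Rightarrow> (real \<Rightarrow> real) \<Rightarrow> real \<Rightarrow> real" where
  "RL a n \<alpha> z = nabla n (GL a (\<alpha> - real n) z)"

definition Caputo :: "real \<Rightarrow> nat \<Rightarrow> real \<Rightarrow> (real \<Rightarrow> real) \<Rightarrow> real \<Rightarrow> real" where
  "Caputo a n \<alpha> z = GL a (\<alpha> - real n) (nabla n z)"

definition tempered ::
  "(real \<Rightarrow> real) \<Rightarrow> ((real \<Rightarrow> real) \<Rightarrow> real \<Rightarrow> real) \<Rightarrow> (real \<Rightarrow> real) \<Rightarrow> real \<Rightarrow> real" where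
  "tempered w D x k = 1 / w k * D (\<lambda>t. w t * x t) k"

end

theory Submission
  imports Defs
begin

text \<open>
  Put z = w x; the tempering cancels.  Expanding the values z (k - l) in the
  Gruenwald--Letnikov sum by the backward Taylor formula with summation remainder gives both sums
  of (1): the coefficient of the i-th difference is an alternating partial sum of a row of
  binomial coefficients, which has a closed form.  Then (2) reduces to (1) because differencing
  the Gruenwald--Letnikov sum n times raises its order by n, and (3) is (1) for
  order \<open>\<alpha> - n\<close>, degree \<open>K - n\<close> and the function \<open>\<nabla>\<^sup>n z\<close>.
\<close>

section \<open>Backward differences and their Taylor formula\<close>

lemma nabla_0 [simp]: "nabla 0 z = z"
  by (simp add: nabla_def fun_eq_iff)

text \<open>Pascal's rule, once the term \<open>i = 0\<close> is split off.\<close>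

lemma nabla_Suc: "nabla (Suc n) z k = nabla n z k - nabla n z (k - 1)"
proof -
  let ?g = "\<lambda>i. (-1) ^ i * z (k - real i)"
  have "nabla (Suc n) z k = ?g 0 + (\<Sum>i\<le>n. real (Suc n choose Suc i) * ?g (Suc i))"
    unfolding nabla_def atMost_atLeast0[symmetric]
    by (subst sum.atMost_Suc_shift) (simp add: mult_ac)
  also have "\<dots> = (?g 0 + (\<Sum>i\<le>n. real (n choose Suc i) * ?g (Suc i)))
                  + (\<Sum>i\<le>n. real (n choose i) * ?g (Suc i))"
    by (simp add: sum.distrib[symmetric] algebra_simps)
  also have "?g 0 + (\<Sum>i\<le>n. real (n choose Suc i) * ?g (Suc i))
      = (\<Sum>i\<le>Suc n. real (n choose i) * ?g i)"
    by (subst sum.atMost_Suc_shift) simp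
  also have "\<dots> = nabla n z k"
    by (simp add: nabla_def atMost_atLeast0 mult_ac)
  also have "(\<Sum>i\<le>n. real (n choose i) * ?g (Suc i)) = - nabla n z (k - 1)"
    by (simp add: nabla_def atMost_atLeast0 sum_negf[symmetric] algebra_simps)
  finally show ?thesis by simp
qed

lemma nabla_nabla: "nabla m (nabla n z) = nabla (m + n) z"
  by (induction m) (simp_all add: nabla_Suc fun_eq_iff)

text \<open>The induction on \<open>l\<close> moves the base point from \<open>k\<close> to
  \<open>k - 1\<close>, hence the arbitrary \<open>k\<close>. Expressing the differences at
  \<open>k - 1\<close> by those at \<open>k\<close> and collecting them with Pascal's rule restores
  the shape.\<close>

lemma nabla_Taylor:
  "z (k - real l) = (\<Sum>i\<le>K. (-1) ^ i * real (l choose i) * nabla i z k)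
     - (-1) ^ K * (\<Sum>s<l. real ((l - 1 - s) choose K) * nabla (Suc K) z (k - real s))"
proof (induction l arbitrary: k)
  case 0
  have "(\<Sum>i\<le>K. (-1) ^ i * real (0 choose i) * nabla i z k) = z k"
    by (induction K) auto
  then show ?case by simp
next
  case (Suc l)
  \<comment> \<open>Pascal's rule merges neighbouring terms. Only a difference of order
    \<open>Suc K\<close> is left over; it becomes the summand \<open>s = 0\<close> of the new
    remainder.\<close>
  have step: "(\<Sum>i\<le>K. (-1) ^ i * real (l choose i) * (nabla i z k - nabla (Suc i) z k))
     = (\<Sum>i\<le>K. (-1) ^ i * real (Suc l choose i) * nabla i z k)
        - (-1) ^ K * real (l choose K) * nabla (Suc K) z k"
    by (induction K) (simp_all add: algebra_simps)
  have shift: "(\<Sum>s<Suc l. real ((Suc l - 1 - s) choose K) * nabla (Suc K) z (k - real s))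
     = real (l choose K) * nabla (Suc K) z k
       + (\<Sum>s<l. real ((l - 1 - s) choose K) * nabla (Suc K) z (k - 1 - real s))"
    by (subst sum.lessThan_Suc_shift) (simp add: algebra_simps)
  have "z (k - real (Suc l)) = z (k - 1 - real l)"
    by (simp add: algebra_simps)
  also have "\<dots> = (\<Sum>i\<le>K. (-1) ^ i * real (l choose i) * nabla i z (k - 1))
     - (-1) ^ K * (\<Sum>s<l. real ((l - 1 - s) choose K) * nabla (Suc K) z (k - 1 - real s))"
    by (rule Suc.IH)
  also have "(\<Sum>i\<le>K. (-1) ^ i * real (l choose i) * nabla i z (k - 1))
      = (\<Sum>i\<le>K. (-1) ^ i * real (l choose i) * (nabla i z k - nabla (Suc i) z k))"
    by (simp add: nabla_Suc)
  finally show ?case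
    unfolding step shift by (simp add: algebra_simps)
qed

section \<open>Differencing the Gruenwald-Letnikov sum\<close>

text \<open>Pascal's rule for generalized binomial coefficients. For \<open>k < a + 1\<close> all
  three sums are empty, so the identity can be iterated at every real \<open>k\<close>.\<close>

lemma GL_diff: "GL a \<beta> z k - GL a \<beta> z (k - 1) = GL a (\<beta> + 1) z k"
proof (cases "k - a - 1 < 0")
  case True
  then have "{i. real i \<le> k - a - 1} = {}" "{i. real i \<le> k - 1 - a - 1} = {}" by auto
  then show ?thesis by (simp add: GL_def)
next
  case False
  \<comment> \<open>The sum at \<open>k\<close> has exactly one term more than the sum at
    \<open>k - 1\<close>, even if \<open>k - a\<close> is not an integer.\<close>
  define M where "M = nat \<lfloor>k - a - 1\<rfloor>"
  have A: "{i. real i \<le> k - a - 1} = {..<Suc M}" and B: "{i. real i \<le> k - 1 - a - 1} = {..<M}"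
    using False by (auto simp: M_def le_floor_iff; linarith)+
  have "GL a (\<beta> + 1) z k = z k
      + (\<Sum>i<M. (-1) ^ Suc i * ((\<beta> + 1) gchoose Suc i) * z (k - real (Suc i)))"
    unfolding GL_def A by (subst sum.lessThan_Suc_shift) simp
  also have "\<dots> = (z k + (\<Sum>i<M. (-1) ^ Suc i * (\<beta> gchoose Suc i) * z (k - real (Suc i))))
      + (\<Sum>i<M. (-1) ^ Suc i * (\<beta> gchoose i) * z (k - real (Suc i)))"
    unfolding gbinomial_Suc_Suc ring_distribs sum.distrib by (simp only: add_ac)
  also have "z k + (\<Sum>i<M. (-1) ^ Suc i * (\<beta> gchoose Suc i) * z (k - real (Suc i))) = GL a \<beta> z k"
    unfolding GL_def A by (subst sum.lessThan_Suc_shift) simp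
  also have "(\<Sum>i<M. (-1) ^ Suc i * (\<beta> gchoose i) * z (k - real (Suc i))) = - GL a \<beta> z (k - 1)"
    unfolding GL_def B by (simp add: sum_negf[symmetric] algebra_simps)
  finally show ?thesis by simp
qed

lemma RL_eq_GL: "RL a n \<alpha> z = GL a \<alpha> z"
proof -
  have "nabla n (GL a \<beta> z) = GL a (\<beta> + real n) z" for \<beta>
    by (induction n) (simp_all add: fun_eq_iff nabla_Suc GL_diff algebra_simps)
  then show ?thesis by (simp add: RL_def)
qed

section \<open>The rising function and the two kinds of weights\<close>

text \<open>Away from the poles at \<open>p\<close> the two branches of \<open>rising\<close> agree,
  so no case distinction on \<open>q\<close> is needed there.\<close>

lemma rising_eq_Gamma:
  assumes "p \<notin> \<int>\<^sub>\<le>\<^sub>0"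
  shows "rising p q = Gamma (p + q) / Gamma p"
  using assms by (auto simp: rising_def pochhammer_Gamma elim!: Nats_cases)

lemma rising_of_nat: "rising p (real q) = pochhammer p q"
  by (simp add: rising_def)

text \<open>Both sides are \<open>pochhammer (- \<alpha>) l / fact l\<close>: the kernel of the
  remainder is a Gruenwald-Letnikov coefficient.\<close>

lemma remainder_weight:
  assumes "\<alpha> \<notin> \<nat> - {0}" and "l > 0"
  shows "rising (real l + 1) (- \<alpha> - 1) / Gamma (- \<alpha>) = (-1) ^ l * (\<alpha> gchoose l)"
proof (cases "\<alpha> = 0")
  \<comment> \<open>Division by \<open>Gamma 0 = 0\<close> makes the left side 0; the right side is
    0 because \<open>l > 0\<close>, whereas it would be 1 at \<open>l = 0\<close>.\<close>
  case True
  then show ?thesis using assms(2) by (simp add: gbinomial_pochhammer pochhammer_0_left)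
next
  case False
  then have "\<alpha> \<notin> \<nat>" using assms by auto
  then have na: "- \<alpha> \<notin> \<int>\<^sub>\<le>\<^sub>0" by (simp add: uminus_in_nonpos_Ints_iff)
  have "real l + 1 \<notin> \<int>\<^sub>\<le>\<^sub>0" by (auto elim!: nonpos_Ints_cases)
  then have "rising (real l + 1) (- \<alpha> - 1) = Gamma (real l - \<alpha>) / Gamma (real l + 1)"
    by (simp add: rising_eq_Gamma)
  moreover have "Gamma (real l + 1) = fact l" using Gamma_fact[of l] by (simp add: add.commute)
  ultimately show ?thesis
    using pochhammer_Gamma[OF na, of l]
    by (simp add: gbinomial_pochhammer power_mult_distrib[symmetric] mult.commute)
qed

text \<open>Here the product reading of \<open>rising\<close> matters, since both Gammas may have
  poles. A factor 0 occurs exactly when \<open>d < K\<close>.\<close>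

lemma rising_neg_nat: "rising (- real d) (real K) / fact K = (-1) ^ K * real (d choose K)"
  by (simp add: rising_of_nat binomial_gbinomial gbinomial_pochhammer
      power_mult_distrib[symmetric])

text \<open>Terms with \<open>l < i\<close> vanish. After a shift by \<open>i\<close>, trinomial
  revision pulls out \<open>\<alpha> gchoose i\<close> and leaves an alternating partial sum of row
  \<open>\<alpha> - i\<close>, which is one signed entry of row
  \<open>\<alpha> - i - 1\<close>.\<close>

lemma sum_alternating_gbinomial:
  fixes \<alpha> :: real
  assumes "i < N"
  shows "(\<Sum>l<N. (-1) ^ l * (\<alpha> gchoose l) * ((-1) ^ i * real (l choose i)))
       = (\<alpha> gchoose i) * (pochhammer (real i - \<alpha> + 1) (N - 1 - i) / fact (N - 1 - i))"
proof -
  let ?h = "\<lambda>l. (-1) ^ l * (\<alpha> gchoose l) * ((-1) ^ i * real (l choose i))"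
  have "(\<Sum>l<N. ?h l) = (\<Sum>l\<in>{i..<N}. ?h l)"
    by (rule sum.mono_neutral_right) auto
  also have "\<dots> = (\<Sum>m\<le>N - 1 - i. ?h (m + i))"
    by (rule sum.reindex_bij_witness[of _ "\<lambda>m. m + i" "\<lambda>l. l - i"]) (use assms in auto)
  also have "\<dots> = (\<Sum>m\<le>N - 1 - i. (\<alpha> gchoose i) * (((\<alpha> - real i) gchoose m) * (-1) ^ m))"
  proof (rule sum.cong[OF refl])
    fix m
    have "(\<alpha> gchoose (m + i)) * real ((m + i) choose i) = (\<alpha> gchoose i) * ((\<alpha> - real i) gchoose m)"
      using gbinomial_trinomial_revision[of i "m + i" \<alpha>] by (simp add: binomial_gbinomial)
    moreover have "(-1 :: real) ^ (m + i) * (-1) ^ i = (-1) ^ m"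
      by (simp add: power_add mult.assoc power_mult_distrib[symmetric])
    ultimately show "?h (m + i) = (\<alpha> gchoose i) * (((\<alpha> - real i) gchoose m) * (-1) ^ m)"
      by (metis (no_types, lifting) mult.assoc mult.commute mult.left_commute)
  qed
  also have "\<dots> = (\<alpha> gchoose i) * ((-1) ^ (N - 1 - i) * ((\<alpha> - real i - 1) gchoose (N - 1 - i)))"
    by (simp only: sum_distrib_left[symmetric] gbinomial_sum_lower_neg)
  also have "(-1) ^ (N - 1 - i) * ((\<alpha> - real i - 1) gchoose (N - 1 - i))
      = pochhammer (real i - \<alpha> + 1) (N - 1 - i) / fact (N - 1 - i)"
    by (simp add: gbinomial_pochhammer power_mult_distrib[symmetric] algebra_simps)
  finally show ?thesis .
qed

text \<open>For \<open>i < N\<close> this is the preceding closed form in terms of Gamma. For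
  \<open>i \<ge> N\<close>, which occurs when \<open>K\<close> is large compared with
  \<open>k - a\<close>, both sides vanish.\<close>

lemma Taylor_weight:
  fixes \<alpha> :: real
  assumes \<alpha>: "\<alpha> \<notin> \<nat> - {0}" and N: "N > 0"
  shows "(\<Sum>l<N. (-1) ^ l * (\<alpha> gchoose l) * ((-1) ^ i * real (l choose i)))
       = (\<alpha> gchoose i) * (rising (real N - real i) (real i - \<alpha>) / Gamma (real i - \<alpha> + 1))"
proof (cases "i < N")
  case True
  define M where "M = N - 1 - i"
  have M: "real N - real i = 1 + real M" using True by (simp add: M_def)
  have "1 + real M \<notin> \<int>\<^sub>\<le>\<^sub>0" by (auto elim!: nonpos_Ints_cases)
  then have "rising (1 + real M) (real i - \<alpha>) = Gamma (real i - \<alpha> + 1 + real M) / fact M"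
    by (simp add: rising_eq_Gamma Gamma_fact algebra_simps)
  moreover have "real i - \<alpha> + 1 \<notin> \<int>\<^sub>\<le>\<^sub>0"
  proof
    assume "real i - \<alpha> + 1 \<in> \<int>\<^sub>\<le>\<^sub>0"
    then obtain m where "real i - \<alpha> + 1 = - real m" by (auto elim!: nonpos_Ints_cases')
    then have "\<alpha> = real (i + 1 + m)" by simp
    then show False using \<alpha> by (metis Diff_iff add_is_0 empty_iff insert_iff
      of_nat_eq_0_iff of_nat_in_Nats one_neq_zero)
  qed
  then have "pochhammer (real i - \<alpha> + 1) M = Gamma (real i - \<alpha> + 1 + real M) / Gamma (real i - \<alpha> + 1)"
    by (rule pochhammer_Gamma)
  ultimately show ?thesis
    unfolding sum_alternating_gbinomial[OF True] M M_def[symmetric] by (simp add: mult_ac)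
next
  case False
  then have "(\<Sum>l<N. (-1) ^ l * (\<alpha> gchoose l) * ((-1) ^ i * real (l choose i))) = 0"
    by (intro sum.neutral) auto
  \<comment> \<open>The first argument is a nonpositive integer. If the second is a natural number
    \<open>q\<close>, the condition on \<open>\<alpha>\<close> forces
    \<open>q \<ge> i > i - N\<close>, so the product has a factor 0; otherwise the denominator is
    Gamma at a pole.\<close>
  moreover have "rising (real N - real i) (real i - \<alpha>) = 0"
  proof (cases "real i - \<alpha> \<in> \<nat>")
    case True
    then obtain q where q: "real i - \<alpha> = real q" by (auto elim: Nats_cases)
    have "i \<le> q"
    proof (rule ccontr)
      assume "\<not> i \<le> q"
      then have "\<alpha> = real (i - q)" "i - q \<noteq> 0" using q by auto
      then show False using \<alpha> by auto
    qed
    then have "pochhammer (- real (i - N)) q = 0"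
      using N False by (intro pochhammer_of_nat_eq_0_lemma) auto
    then show ?thesis using False by (simp add: q rising_of_nat of_nat_diff)
  next
    case nn: False
    have "real N - real i = - real (i - N)" using False by (simp add: of_nat_diff)
    then have "real N - real i \<in> \<int>\<^sub>\<le>\<^sub>0" by (simp only: minus_of_nat_in_nonpos_Ints)
    then have "Gamma (real N - real i) = 0" by (simp add: Gamma_eq_zero_iff)
    then show ?thesis using nn by (simp add: rising_def)
  qed
  ultimately show ?thesis by simp
qed

section \<open>Integer index sets and the untempered expansions\<close>

lemma nat_range_shift:
  "nat_range (a + 2) (a + real m) = (\<lambda>i. a + real i) ` {2..m}"
proof -
  have "a + 2 + real r \<in> (\<lambda>i. a + real i) ` {2..m}" if "2 + real r \<le> real m" for r
    using that by (intro image_eqI[of _ _ "r + 2"]) auto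
  moreover have "\<exists>r. a + real i = a + 2 + real r" if "i \<ge> 2" for i
    using that by (intro exI[of _ "i - 2"]) auto
  ultimately show ?thesis
    by (auto simp: nat_range_def nat_from_def)
qed

lemma sum_nat_range:
  "(\<Sum>i\<in>nat_range (a + 2) (a + real m). f i) = (\<Sum>i=2..m. f (a + real i))"
  unfolding nat_range_shift by (subst sum.reindex) (auto simp: inj_on_def)

text \<open>With \<open>nabla_Taylor\<close> applied to each \<open>z (k - l)\<close>, the main part
  is evaluated by \<open>Taylor_weight\<close>; the remainder is only reindexed.\<close>

lemma GL_Taylor:
  fixes z :: "real \<Rightarrow> real"
  assumes \<alpha>: "\<alpha> \<notin> \<nat> - {0}" and k: "k \<in> nat_from (a + 1)"
  shows "GL a \<alpha> z k =
     (\<Sum>i=0..K. (\<alpha> gchoose i) * (rising (k - a - real i) (real i - \<alpha>) / Gamma (real i - \<alpha> + 1))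
             * nabla i z k)
     - (\<Sum>i \<in> nat_range (a + 2) k. nabla (K + 1) z i *
          (\<Sum>j \<in> nat_range (a + 2) i.
             rising (k - j + 2) (- \<alpha> - 1) / Gamma (- \<alpha>) * (rising (j - i) (real K) / fact K)))"
    (is "_ = ?T - ?R")
proof -
  obtain N where N: "N > 0" "k = a + real N"
  proof -
    obtain m where "k = a + 1 + real m" using k by (auto simp: nat_from_def)
    then show thesis using that[of "Suc m"] by simp
  qed
  define c where "c l = (-1) ^ l * (\<alpha> gchoose l)" for l
  define g where "g = (\<lambda>i. nabla (K + 1) z (a + real i))"
  have "{i. real i \<le> k - a - 1} = {..<N}" using N by auto
  then have "GL a \<alpha> z k = (\<Sum>l<N. c l * z (k - real l))"
    by (simp add: GL_def c_def)
  also have "\<dots> = (\<Sum>l<N. c l * (\<Sum>i\<le>K. (-1) ^ i * real (l choose i) * nabla i z k))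
     - (\<Sum>l<N. c l * ((-1) ^ K *
          (\<Sum>s<l. real ((l - 1 - s) choose K) * nabla (K + 1) z (k - real s))))"
    by (subst nabla_Taylor[where K = K]) (simp add: sum_subtractf right_diff_distrib)
  also have "(\<Sum>l<N. c l * (\<Sum>i\<le>K. (-1) ^ i * real (l choose i) * nabla i z k))
      = (\<Sum>i\<le>K. (\<Sum>l<N. c l * ((-1) ^ i * real (l choose i))) * nabla i z k)"
    unfolding sum_distrib_left sum_distrib_right
    by (subst sum.swap) (simp add: mult.assoc)
  also have "\<dots> = ?T"
    unfolding c_def Taylor_weight[OF \<alpha> N(1)] by (simp add: N(2) atMost_atLeast0)
  also have "(\<Sum>l<N. c l * ((-1) ^ K *
          (\<Sum>s<l. real ((l - 1 - s) choose K) * nabla (K + 1) z (k - real s)))) = ?R"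
  proof -
    \<comment> \<open>With \<open>l = N - j + 1\<close> and \<open>d = i - j\<close> the factors are
      those of \<open>remainder_weight\<close> and \<open>rising_neg_nat\<close>.\<close>
    have inner: "rising (a + real N - (a + real j) + 2) (- \<alpha> - 1) / Gamma (- \<alpha>)
         * (rising (a + real j - (a + real i)) (real K) / fact K)
       = c (N - j + 1) * ((-1) ^ K * real ((i - j) choose K))" if "j \<le> i" "i \<le> N" for i j
    proof -
      have l: "a + real N - (a + real j) + 2 = real (N - j + 1) + 1"
        using that by (simp add: of_nat_diff)
      have d: "a + real j - (a + real i) = - real (i - j)"
        using that by (simp add: of_nat_diff)
      have "N - j + 1 > 0" by simp
      then show ?thesis
        unfolding l d rising_neg_nat by (simp only: remainder_weight[OF \<alpha>] c_def)
    qed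
    have "?R = (\<Sum>i=2..N. g i * (\<Sum>j=2..i. c (N - j + 1) * ((-1) ^ K * real ((i - j) choose K))))"
      unfolding N(2) sum_nat_range g_def
      by (rule sum.cong[OF refl], rule arg_cong2[of _ _ _ _ "(*)", OF refl],
          rule sum.cong[OF refl], rule inner) auto
    also have "\<dots> = (\<Sum>(i, j)\<in>(SIGMA i:{2..N}. {2..i}).
        g i * (c (N - j + 1) * ((-1) ^ K * real ((i - j) choose K))))"
      unfolding sum_distrib_left by (subst sum.Sigma) auto
    also have "\<dots> = (\<Sum>(l, s)\<in>(SIGMA l:{..<N}. {..<l}).
        c l * ((-1) ^ K * (real ((l - 1 - s) choose K) * nabla (K + 1) z (k - real s))))"
    \<comment> \<open>Setting \<open>l = N - j + 1\<close> and \<open>s = N - i\<close> turns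
      \<open>2 \<le> j \<le> i \<le> N\<close> into \<open>s < l < N\<close>, which explains the
      lower bound \<open>a + 2\<close>.\<close>
    proof (rule sum.reindex_bij_witness[of _ "\<lambda>(l, s). (N - s, N - l + 1)"
            "\<lambda>(i, j). (N - j + 1, N - i)"], goal_cases)
      case (5 p)
      then obtain i j where p: "p = (i, j)" "2 \<le> j" "j \<le> i" "i \<le> N" by auto
      then have "k - real (N - i) = a + real i" "N - j + 1 - 1 - (N - i) = i - j"
        by (auto simp: N(2) of_nat_diff)
      then show ?case by (simp only: p(1) prod.case g_def mult_ac)
    qed auto
    also have "\<dots> = (\<Sum>l<N. c l * ((-1) ^ K *
          (\<Sum>s<l. real ((l - 1 - s) choose K) * nabla (K + 1) z (k - real s))))"
      unfolding sum_distrib_left by (subst sum.Sigma) auto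
    finally show ?thesis by simp
  qed
  finally show ?thesis .
qed

lemma Caputo_Taylor:
  fixes z :: "real \<Rightarrow> real"
  assumes \<alpha>: "\<alpha> - real n \<notin> \<nat> - {0}" and k: "k \<in> nat_from (a + 1)" and n: "n \<le> K"
  shows "Caputo a n \<alpha> z k =
     (\<Sum>i=n..K. ((\<alpha> - real n) gchoose (i - n))
             * (rising (k - a - real i + real n) (real i - \<alpha>) / Gamma (real i - \<alpha> + 1))
             * nabla i z k)
     - (\<Sum>i \<in> nat_range (a + 2) k. nabla (K + 1) z i *
          (\<Sum>j \<in> nat_range (a + 2) i.
             rising (k - j + 2) (real n - \<alpha> - 1) / Gamma (real n - \<alpha>)
               * (rising (j - i) (real (K - n)) / fact (K - n))))"
proof -
  \<comment> \<open>Lowering \<open>i\<close> by \<open>n\<close> preserves the difference of index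
    and order, so the Gamma factors match those of \<open>GL_Taylor\<close> for order
    \<open>\<alpha> - n\<close>.\<close>
  have "(\<Sum>i=n..K. ((\<alpha> - real n) gchoose (i - n))
             * (rising (k - a - real i + real n) (real i - \<alpha>) / Gamma (real i - \<alpha> + 1))
             * nabla i z k)
      = (\<Sum>i=0..K - n. ((\<alpha> - real n) gchoose i)
             * (rising (k - a - real i) (real i - (\<alpha> - real n)) / Gamma (real i - (\<alpha> - real n) + 1))
             * nabla (i + n) z k)"
    by (rule sum.reindex_bij_witness[of _ "\<lambda>i. i + n" "\<lambda>i. i - n"])
       (use n in \<open>auto simp: of_nat_diff algebra_simps\<close>)
  \<comment> \<open>The orders of the differences add up, and \<open>K - n + 1 + n = K + 1\<close>
    because \<open>n \<le> K\<close>.\<close>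
  then show ?thesis
    using n unfolding Caputo_def GL_Taylor[OF \<alpha> k, where K = "K - n"]
    by (simp add: nabla_nabla)
qed

section \<open>Removing the tempering\<close>

text \<open>The factor \<open>w i\<close> cancels the \<open>1 / w i\<close> inside
  \<open>tempered\<close>; \<open>i \<ge> a + 2\<close> lies in the domain where \<open>w\<close> is
  nonzero.\<close>

lemma sum_tempered_remainder:
  assumes "\<forall>t \<in> nat_from (a - real K - 1). w t \<noteq> 0"
  shows "(\<Sum>i \<in> nat_range (a + 2) k. w i / w k * tempered w D x i * f i)
      = 1 / w k * (\<Sum>i \<in> nat_range (a + 2) k. D (\<lambda>t. w t * x t) i * f i)"
proof -
  have "w i \<noteq> 0" if i: "i \<in> nat_range (a + 2) k" for i
  proof -
    obtain m where "i = a + 2 + real m" using i unfolding nat_range_def nat_from_def by blast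
    then have "i = a - real K - 1 + real (K + 3 + m)" by simp
    then have "i \<in> nat_from (a - real K - 1)" unfolding nat_from_def by blast
    then show ?thesis using assms by blast
  qed
  then show ?thesis
    unfolding sum_distrib_left by (intro sum.cong) (auto simp: tempered_def)
qed

lemma sum_tempered:
  "(\<Sum>i\<in>A. f i * tempered w (D i) x k) = 1 / w k * (\<Sum>i\<in>A. f i * D i (\<lambda>t. w t * x t) k)"
  unfolding tempered_def sum_distrib_left by (simp add: mult_ac)

theorem theorem8:
  fixes a k :: real and K :: nat and x w :: "real \<Rightarrow> real"
  assumes w_nonzero: "\<forall>t \<in> nat_from (a - real K - 1). w t \<noteq> 0"
    and k: "k \<in> nat_from (a + 1)"
  shows
    "(\<forall>\<alpha> :: real. \<alpha> \<notin> \<nat> - {0} \<longrightarrow>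
        tempered w (GL a \<alpha>) x k =
          (\<Sum>i = 0..K. (\<alpha> gchoose i) * (rising (k - a - real i) (real i - \<alpha>) / Gamma (real i - \<alpha> + 1))
             * tempered w (nabla i) x k)
          - (\<Sum>i \<in> nat_range (a + 2) k. w i / w k * tempered w (nabla (K + 1)) x i *
               (\<Sum>j \<in> nat_range (a + 2) i.
                  rising (k - j + 2) (- \<alpha> - 1) / Gamma (- \<alpha>) * (rising (j - i) (real K) / fact K))))
     \<and>
     (\<forall>(n :: nat) (\<alpha> :: real). n \<ge> 1 \<longrightarrow> \<alpha> \<in> {real n - 1 <..< real n} \<longrightarrow>
        tempered w (RL a n \<alpha>) x k =
          (\<Sum>i = 0..K. (\<alpha> gchoose i) * (rising (k - a - real i) (real i - \<alpha>) / Gamma (real i - \<alpha> + 1))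
             * tempered w (nabla i) x k)
          - (\<Sum>i \<in> nat_range (a + 2) k. w i / w k * tempered w (nabla (K + 1)) x i *
               (\<Sum>j \<in> nat_range (a + 2) i.
                  rising (k - j + 2) (- \<alpha> - 1) / Gamma (- \<alpha>) * (rising (j - i) (real K) / fact K))))
     \<and>
     (\<forall>(n :: nat) (\<alpha> :: real). n \<ge> 1 \<longrightarrow> \<alpha> \<in> {real n - 1 <..< real n} \<longrightarrow> K \<ge> n \<longrightarrow>
        tempered w (Caputo a n \<alpha>) x k =
          (\<Sum>i = n..K. ((\<alpha> - real n) gchoose (i - n))
             * (rising (k - a - real i + real n) (real i - \<alpha>) / Gamma (real i - \<alpha> + 1))
             * tempered w (nabla i) x k)
          - (\<Sum>i \<in> nat_range (a + 2) k. w i / w k * tempered w (nabla (K + 1)) x i *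
               (\<Sum>j \<in> nat_range (a + 2) i.
                  rising (k - j + 2) (real n - \<alpha> - 1) / Gamma (real n - \<alpha>)
                  * (rising (j - i) (real (K - n)) / fact (K - n)))))"
proof -
  note expand = sum_tempered sum_tempered_remainder[OF w_nonzero] right_diff_distrib[symmetric]
  have GL: "tempered w (GL a \<alpha>) x k = 1 / w k * GL a \<alpha> (\<lambda>t. w t * x t) k" for \<alpha>
    by (simp add: tempered_def)
  have RL: "tempered w (RL a n \<alpha>) x k = 1 / w k * GL a \<alpha> (\<lambda>t. w t * x t) k" for n \<alpha>
    by (simp add: tempered_def RL_eq_GL)
  have C: "tempered w (Caputo a n \<alpha>) x k = 1 / w k * Caputo a n \<alpha> (\<lambda>t. w t * x t) k" for n \<alpha>
    by (simp add: tempered_def)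
  have not_Nat: "\<alpha> \<notin> \<nat> - {0}" if "\<alpha> \<in> {real n - 1 <..< real n}" for \<alpha> n
    using that by (auto elim!: Nats_cases)
  \<comment> \<open>Here \<open>\<alpha> - n\<close> lies strictly between -1 and 0.\<close>
  have not_Nat': "\<alpha> - real n \<notin> \<nat> - {0}" if "\<alpha> \<in> {real n - 1 <..< real n}" for \<alpha> n
    using that by (auto elim!: Nats_cases)
  \<comment> \<open>After unfolding, both sides of each equation carry the factor
    \<open>1 / w k\<close>; removing it leaves the expansions for \<open>z = w x\<close>.\<close>
  show ?thesis
    unfolding expand GL RL C
    by (intro conjI allI impI arg_cong[of _ _ "(*) (1 / w k)"]
        GL_Taylor[OF _ k] Caputo_Taylor[OF not_Nat' k]; (assumption | erule not_Nat))
qed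

end
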